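(* A topological space is a profinite space if and only if it is compact (that is, quasi-compact and Hausdorff) and totally disconnected.
   Context: Let $(I,<)$ be a poset and let $(X_i,\phi_{i,j})$ be a projective (inverse) system of finite discrete spaces over $I$: each $X_i$ ($i\in I$) is a finite discrete space, and for $j\le i$ there is a map $\phi_{i,j}:X_i\to X_j$, with $\phi_{i,i}=\mathrm{id}$ and $\phi_{j,k}\circ\phi_{i,j}=\phi_{i,k}$ for $k\le j\le i$. Its projective limit is the subset $\{(x_i)\in\prod_{i\in I}X_i:\phi_{i,j}(x_i)=x_j\text{ for all }j\le i\}$ with the topology induced from the product topology. A profinite space is a topological space that is (homeomorphic to) such a projective limit. Quasi-compact means that every open covering has a finite subcovering; compact means quasi-compact and Hausdorff. A space is totally disconnected if its connected subsets have at most one point. *)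

theory Defs
  imports "HOL-Analysis.Analysis"
begin

text \<open>
  A projective system of finite sets over the poset \<open>(I, r)\<close>. A pair \<open>(j, i) \<in> r\<close> means \<open>j \<le> i\<close>, and
  \<open>\<phi> i j\<close> is then the transition map \<open>Y i \<rightarrow> Y j\<close>. The poset is not assumed to be directed. Only
  the values of \<open>\<phi> i j\<close> on \<open>Y i\<close> for \<open>j \<le> i\<close> matter.
\<close>

definition finite_projective_system ::
    "'i set \<Rightarrow> 'i rel \<Rightarrow> ('i \<Rightarrow> 'b set) \<Rightarrow> ('i \<Rightarrow> 'i \<Rightarrow> 'b \<Rightarrow> 'b) \<Rightarrow> bool" where
  "finite_projective_system I r Y \<phi> \<longleftrightarrow>
     partial_order_on I r \<and>
     (\<forall>i\<in>I. finite (Y i)) \<and>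
     (\<forall>i j. (j, i) \<in> r \<longrightarrow> \<phi> i j \<in> Y i \<rightarrow> Y j) \<and>
     (\<forall>i\<in>I. \<forall>x\<in>Y i. \<phi> i i x = x) \<and>
     (\<forall>i j k. (k, j) \<in> r \<longrightarrow> (j, i) \<in> r \<longrightarrow> (\<forall>x\<in>Y i. \<phi> j k (\<phi> i j x) = \<phi> i k x))"

definition projective_limit ::
    "'i set \<Rightarrow> 'i rel \<Rightarrow> ('i \<Rightarrow> 'b set) \<Rightarrow> ('i \<Rightarrow> 'i \<Rightarrow> 'b \<Rightarrow> 'b) \<Rightarrow> ('i \<Rightarrow> 'b) topology" where
  "projective_limit I r Y \<phi> =
     subtopology (product_topology (\<lambda>i. discrete_topology (Y i)) I)
       {x \<in> (\<Pi>\<^sub>E i\<in>I. Y i). \<forall>i j. (j, i) \<in> r \<longrightarrow> \<phi> i j (x i) = x j}"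

text \<open>
  HOL cannot quantify existentially over the types holding the indices and the points of the
  \<open>Y i\<close>, so these types are parameters here.
\<close>

definition profinite_space_over :: "'i itself \<Rightarrow> 'b itself \<Rightarrow> 'a topology \<Rightarrow> bool" where
  "profinite_space_over _ _ X \<longleftrightarrow>
     (\<exists>(I :: 'i set) r (Y :: 'i \<Rightarrow> 'b set) \<phi>.
        finite_projective_system I r Y \<phi> \<and> X homeomorphic_space projective_limit I r Y \<phi>)"

text \<open>
  For a space with points in \<open>'a\<close>, the types below are large enough for the system of all finite
  partitions of the space into open sets: a partition has type \<open>'a set set\<close> and its blocks have
  type \<open>'a set\<close>. That no choice of types yields further profinite spaces is a claim to be proved
  alongside any use of this definition as the type-independent notion.
\<close>

definition profinite_space :: "'a topology \<Rightarrow> bool" where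
  "profinite_space X \<longleftrightarrow> profinite_space_over TYPE('a set set) TYPE('a set) X"

definition totally_disconnected_space :: "'a topology \<Rightarrow> bool" where
  "totally_disconnected_space X \<longleftrightarrow> (\<forall>S. connectedin X S \<longrightarrow> (\<exists>a. S \<subseteq> {a}))"

end

theory Submission
  imports Defs
begin

text \<open>
  A projective limit of finite discrete spaces is cut out of a product of finite discrete spaces by
  equations between continuous maps into Hausdorff spaces. It is therefore a closed subspace of a
  compact Hausdorff space (Tychonoff). Each coordinate is constant on a connected set, because it
  maps that set into a discrete space; so connected sets have at most one point. None of this depends
  on the types of the indices and of the points, so it also gives the second half of the theorem,
  once the converse is known.

  Conversely, let \<open>X\<close> be compact, Hausdorff and totally disconnected. The finite partitions of
  \<open>X\<close> into nonempty open sets, ordered by refinement, form a projective system: a block of a finer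
  partition goes to the block of the coarser one around it. Sending a point to the block around
  it in every partition is a continuous map from \<open>X\<close> to the limit of this system. As \<open>X\<close> is compact
  and the limit is Hausdorff, it remains to see that this map is bijective.
  \<^item> It is injective because in a compact Hausdorff space the quasi-components are the connected
    components. Here the latter are points, so two different points are separated by a partition
    into two open sets (lemma \<open>open_partition_separating_points\<close>).
  \<^item> It is surjective by compactness. A point of the limit is a coherent choice of one block from
    every partition; finitely many of the chosen blocks all contain the block chosen from a common
    refinement, so they have a common point. Blocks are closed, hence all of the chosen blocks have
    a common point (lemma \<open>coherent_blocks_have_common_point\<close>).
\<close>


section \<open>Projective limits are compact, Hausdorff and totally disconnected\<close>

lemma totally_disconnected_space_if_injects:
  assumes f: "continuous_map X Y f" and inj: "inj_on f (topspace X)"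
    and Y: "totally_disconnected_space Y"
  shows "totally_disconnected_space X"
  unfolding totally_disconnected_space_def
proof (intro allI impI)
  fix S assume S: "connectedin X S"
  then obtain b where b: "f ` S \<subseteq> {b}"
    using Y connectedin_continuous_map_image[OF f] unfolding totally_disconnected_space_def by blast
  have "x = y" if "x \<in> S" "y \<in> S" for x y
  proof (rule inj_onD[OF inj])
    show "f x = f y"
      using that b by blast
  qed (use that connectedin_subset_topspace[OF S] in auto)
  then show "\<exists>a. S \<subseteq> {a}"
    by blast
qed

text \<open>
  A coordinate maps a connected set into a discrete space, hence to a single value; a function in the
  product is determined by its values on the index set because it is extensional.
\<close>

lemma totally_disconnected_product_of_discrete:
  "totally_disconnected_space (product_topology (\<lambda>i. discrete_topology (Y i)) I)"
  unfolding totally_disconnected_space_def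
proof (intro allI impI)
  let ?P = "product_topology (\<lambda>i. discrete_topology (Y i)) I"
  fix S assume S: "connectedin ?P S"
  have "x = y" if xy: "x \<in> S" "y \<in> S" for x y
  proof (rule extensionalityI)
    show "x \<in> extensional I" "y \<in> extensional I"
      using xy connectedin_subset_topspace[OF S] by (auto simp: PiE_def)
    fix i assume i: "i \<in> I"
    have "connectedin (discrete_topology (Y i)) ((\<lambda>z. z i) ` S)"
      using connectedin_continuous_map_image[OF continuous_map_product_projection[OF i] S] .
    then show "x i = y i"
      using xy unfolding connectedin_discrete_topology by blast
  qed
  then show "\<exists>a. S \<subseteq> {a}"
    by blast
qed

text \<open>
  Each relation of the system defines the equalizer of two continuous maps into a discrete, hence
  Hausdorff, space, which is closed; the limit is their intersection.
\<close>

lemma closedin_projective_limit: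
  assumes "finite_projective_system I r Y \<phi>"
  shows "closedin (product_topology (\<lambda>i. discrete_topology (Y i)) I)
           {x \<in> (\<Pi>\<^sub>E i\<in>I. Y i). \<forall>i j. (j, i) \<in> r \<longrightarrow> \<phi> i j (x i) = x j}"
proof -
  let ?P = "product_topology (\<lambda>i. discrete_topology (Y i)) I"
  have r: "r \<subseteq> I \<times> I"
    and maps: "\<And>i j. (j, i) \<in> r \<Longrightarrow> \<phi> i j \<in> Y i \<rightarrow> Y j"
    using assms by (auto simp: finite_projective_system_def dest: partial_order_onD)
  have closed: "closedin ?P {x \<in> topspace ?P. \<phi> i j (x i) = x j}" if ji: "(j, i) \<in> r" for i j
  proof (rule closedin_continuous_maps_eq)
    show "Hausdorff_space (discrete_topology (Y j))"
      by (rule Hausdorff_space_discrete_topology)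
    have i: "i \<in> I" and j: "j \<in> I"
      using ji r by auto
    show "continuous_map ?P (discrete_topology (Y j)) (\<lambda>x. x j)"
      by (rule continuous_map_product_projection[OF j])
    have "continuous_map (discrete_topology (Y i)) (discrete_topology (Y j)) (\<phi> i j)"
      using maps[OF ji] by simp
    moreover have "continuous_map ?P (discrete_topology (Y i)) (\<lambda>x. x i)"
      by (rule continuous_map_product_projection[OF i])
    ultimately show "continuous_map ?P (discrete_topology (Y j)) (\<lambda>x. \<phi> i j (x i))"
      using continuous_map_compose[of ?P _ "\<lambda>x. x i", unfolded o_def] by blast
  qed
  have "{x \<in> (\<Pi>\<^sub>E i\<in>I. Y i). \<forall>i j. (j, i) \<in> r \<longrightarrow> \<phi> i j (x i) = x j}
        = topspace ?P \<inter> \<Inter> ((\<lambda>(j, i). {x \<in> topspace ?P. \<phi> i j (x i) = x j}) ` r)"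
    by auto
  also have "closedin ?P \<dots>"
  proof (cases "r = {}")
    case True
    then show ?thesis
      by (simp only: image_empty Inter_empty Int_UNIV_right closedin_topspace)
  next
    case False
    then show ?thesis
      using closed by (intro closedin_Int closedin_topspace closedin_Inter) auto
  qed
  finally show ?thesis .
qed

lemma
  assumes "finite_projective_system I r Y \<phi>"
  shows compact_space_projective_limit: "compact_space (projective_limit I r Y \<phi>)"
    and Hausdorff_space_projective_limit: "Hausdorff_space (projective_limit I r Y \<phi>)"
    and totally_disconnected_space_projective_limit:
      "totally_disconnected_space (projective_limit I r Y \<phi>)"
proof -
  let ?P = "product_topology (\<lambda>i. discrete_topology (Y i)) I"
  have "compact_space ?P"
    using assms
    by (simp add: compact_space_product_topology compact_space_discrete_topology
        finite_projective_system_def)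
  then show "compact_space (projective_limit I r Y \<phi>)"
    unfolding projective_limit_def
    by (intro compact_space_subtopology closedin_compact_space closedin_projective_limit[OF assms])
  show "Hausdorff_space (projective_limit I r Y \<phi>)"
    unfolding projective_limit_def
    by (simp add: Hausdorff_space_subtopology Hausdorff_space_product_topology)
  show "totally_disconnected_space (projective_limit I r Y \<phi>)"
  proof (rule totally_disconnected_space_if_injects[OF _ _ totally_disconnected_product_of_discrete])
    show "continuous_map (projective_limit I r Y \<phi>) ?P (\<lambda>x. x)"
      unfolding projective_limit_def by (simp add: continuous_map_from_subtopology)
  qed simp
qed

lemma profinite_space_over_imp:
  assumes "profinite_space_over TYPE('i) TYPE('b) X"
  shows "compact_space X \<and> Hausdorff_space X \<and> totally_disconnected_space X"
proof -
  from assms obtain I :: "'i set" and r and Y :: "'i \<Rightarrow> 'b set" and \<phi>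
    where sys: "finite_projective_system I r Y \<phi>"
      and hom: "X homeomorphic_space projective_limit I r Y \<phi>"
    unfolding profinite_space_over_def by blast
  from hom obtain f where f: "homeomorphic_map X (projective_limit I r Y \<phi>) f"
    unfolding homeomorphic_space by blast
  have "totally_disconnected_space X"
    using totally_disconnected_space_if_injects
      [OF homeomorphic_imp_continuous_map[OF f] homeomorphic_imp_injective_map[OF f]
        totally_disconnected_space_projective_limit[OF sys]] .
  then show ?thesis
    using homeomorphic_compact_space[OF hom] homeomorphic_Hausdorff_space[OF hom]
      compact_space_projective_limit[OF sys] Hausdorff_space_projective_limit[OF sys]
    by blast
qed


section \<open>The projective system of finite open partitions\<close>

definition finite_open_partitions :: "'a topology \<Rightarrow> 'a set set set" where
  "finite_open_partitions X =
     {P. partition_on (topspace X) P \<and> finite P \<and> (\<forall>B\<in>P. openin X B)}"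

text \<open>
  Taking a set instead of a point below lets the same function serve both as the transition map
  from blocks of a finer partition and, on singletons, as the projection of \<open>X\<close> onto a partition.
\<close>

definition block_around :: "'a set set \<Rightarrow> 'a set \<Rightarrow> 'a set" where
  "block_around P A = (THE B. B \<in> P \<and> A \<subseteq> B)"

definition coarsening_order :: "'a topology \<Rightarrow> 'a set set rel" where
  "coarsening_order X =
     {(Q, P). Q \<in> finite_open_partitions X \<and> P \<in> finite_open_partitions X \<and>
              refines (topspace X) P Q}"

abbreviation (input) limit_of_open_partitions :: "'a topology \<Rightarrow> ('a set set \<Rightarrow> 'a set) topology"
  where
  "limit_of_open_partitions X \<equiv>
     projective_limit (finite_open_partitions X) (coarsening_order X) (\<lambda>P. P) (\<lambda>P. block_around)"

lemma block_around_eq: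
  assumes "partition_on S P" "B \<in> P" "A \<subseteq> B" "A \<noteq> {}"
  shows "block_around P A = B"
  unfolding block_around_def
proof (rule the_equality)
  fix C assume "C \<in> P \<and> A \<subseteq> C"
  with assms show "C = B"
    using disjointD[OF partition_onD2[OF assms(1)], of C B] by blast
qed (use assms in simp)

lemma block_around_point:
  assumes "partition_on S P" "x \<in> S"
  shows "block_around P {x} \<in> P" "x \<in> block_around P {x}"
proof -
  obtain B where "B \<in> P" "x \<in> B"
    using assms by (auto simp: partition_on_def)
  then show "block_around P {x} \<in> P" "x \<in> block_around P {x}"
    using block_around_eq[OF assms(1), of B "{x}"] by auto
qed

lemma block_around_refines:
  assumes "refines S P Q" "A \<in> P"
  shows "block_around Q A \<in> Q" "A \<subseteq> block_around Q A"
proof -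
  obtain B where "B \<in> Q" "A \<subseteq> B"
    using assms by (auto simp: refines_def)
  moreover have "A \<noteq> {}" "partition_on S Q"
    using assms partition_onD3 by (auto simp: refines_def)
  ultimately show "block_around Q A \<in> Q" "A \<subseteq> block_around Q A"
    using block_around_eq by metis+
qed

text \<open>
  With \<open>A\<close> a block of a partition finer than \<open>P\<close>, this is the functoriality of the transition maps;
  with \<open>A\<close> a singleton, it says that the blocks around a point form an element of the limit.
\<close>

lemma block_around_block_around:
  assumes PQ: "refines S P Q" and P: "block_around P A \<in> P" "A \<subseteq> block_around P A" and "A \<noteq> {}"
  shows "block_around Q (block_around P A) = block_around Q A"
proof (rule sym, rule block_around_eq)
  show "partition_on S Q"
    using PQ by (simp add: refines_def)
  show "block_around Q (block_around P A) \<in> Q"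
    using block_around_refines(1)[OF PQ P(1)] .
  show "A \<subseteq> block_around Q (block_around P A)"
    using P(2) block_around_refines(2)[OF PQ P(1)] by (rule subset_trans)
qed fact

text \<open>
  The complement of a block is the union of the other blocks, which are open.
\<close>

lemma closedin_block:
  assumes "P \<in> finite_open_partitions X" "B \<in> P"
  shows "closedin X B"
proof -
  have part: "partition_on (topspace X) P" and op: "\<And>C. C \<in> P \<Longrightarrow> openin X C"
    using assms(1) by (auto simp: finite_open_partitions_def)
  have "topspace X - B = \<Union> (P - {B})"
    using partition_onD1[OF part] disjointD[OF partition_onD2[OF part] assms(2)] by blast
  moreover have "openin X (\<Union> (P - {B}))"
    using op by blast
  moreover have "B \<subseteq> topspace X"
    using op[OF assms(2)] openin_subset by blast
  ultimately show ?thesis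
    by (simp add: closedin_def)
qed

lemma finite_projective_system_open_partitions:
  "finite_projective_system (finite_open_partitions X) (coarsening_order X) (\<lambda>P. P)
     (\<lambda>P. block_around)"
  unfolding finite_projective_system_def
proof (intro conjI allI ballI impI)
  let ?I = "finite_open_partitions X"
  have part: "partition_on (topspace X) P" if "P \<in> ?I" for P
    using that by (simp add: finite_open_partitions_def)
  show "partial_order_on ?I (coarsening_order X)"
    unfolding partial_order_on_def preorder_on_def
  proof (intro conjI)
    show "coarsening_order X \<subseteq> ?I \<times> ?I"
      by (auto simp: coarsening_order_def)
    show "refl_on ?I (coarsening_order X)"
      by (auto simp: refl_on_def coarsening_order_def intro: refines_refl part)
    show "trans (coarsening_order X)"
      by (rule transI) (auto simp: coarsening_order_def dest: refines_trans)
    show "antisym (coarsening_order X)"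
      by (rule antisymI) (auto simp: coarsening_order_def dest: refines_asym)
  qed
  show "finite P" if "P \<in> ?I" for P
    using that by (simp add: finite_open_partitions_def)
  show "block_around Q \<in> P \<rightarrow> Q" if "(Q, P) \<in> coarsening_order X" for P Q
    using that by (auto simp: coarsening_order_def intro: block_around_refines)
  show "block_around P B = B" if "P \<in> ?I" "B \<in> P" for P B
    using block_around_eq[OF part[OF that(1)] that(2), of B] partition_onD3[OF part[OF that(1)]] that
    by auto
  show "block_around R (block_around Q B) = block_around R B"
    if "(R, Q) \<in> coarsening_order X" "(Q, P) \<in> coarsening_order X" "B \<in> P" for P Q R B
  proof (rule block_around_block_around)
    show "refines (topspace X) Q R"
      using that by (simp add: coarsening_order_def)
    have PQ: "refines (topspace X) P Q"
      using that by (simp add: coarsening_order_def)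
    show "block_around Q B \<in> Q" "B \<subseteq> block_around Q B"
      using block_around_refines[OF PQ that(3)] .
    show "B \<noteq> {}"
      using PQ that(3) by (auto simp: refines_def partition_on_def)
  qed
qed


section \<open>Compact totally disconnected spaces are limits of their finite open partitions\<close>

lemma common_refinement_in_finite_open_partitions:
  assumes "finite \<P>" "\<P> \<noteq> {}" "\<P> \<subseteq> finite_open_partitions X"
  shows "common_refinement \<P> \<in> finite_open_partitions X"
  unfolding finite_open_partitions_def
proof (intro CollectI conjI ballI)
  show "partition_on (topspace X) (common_refinement \<P>)"
    using assms by (intro partition_on_common_refinement) (auto simp: finite_open_partitions_def)
  have "finite (\<Pi>\<^sub>E P\<in>\<P>. P)"
    using assms by (intro finite_PiE) (auto simp: finite_open_partitions_def)
  then show "finite (common_refinement \<P>)"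
    by (simp add: common_refinement_def)
  fix B assume "B \<in> common_refinement \<P>"
  then obtain f where f: "f \<in> (\<Pi>\<^sub>E P\<in>\<P>. P)" and B: "B = \<Inter> (f ` \<P>)"
    by (auto simp: common_refinement_def)
  have "openin X (f P)" if "P \<in> \<P>" for P
  proof -
    have "P \<in> finite_open_partitions X" "f P \<in> P"
      using that assms(3) f by auto
    then show ?thesis
      by (simp add: finite_open_partitions_def)
  qed
  then show "openin X B"
    unfolding B using assms(1,2) by (intro openin_Inter) auto
qed

text \<open>
  The finite intersection property holds since common refinements of finitely many finite open
  partitions are again finite open partitions: the block that \<open>c\<close> chooses there lies in the blocks
  chosen from all of the refined ones, and it is nonempty.
\<close>

lemma coherent_blocks_have_common_point:
  assumes "compact_space X" and c: "c \<in> topspace (limit_of_open_partitions X)"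
  shows "\<exists>x\<in>topspace X. \<forall>P\<in>finite_open_partitions X. x \<in> c P"
proof -
  let ?I = "finite_open_partitions X"
  have part: "partition_on (topspace X) P" if "P \<in> ?I" for P
    using that by (simp add: finite_open_partitions_def)
  have c_block: "c P \<in> P" if "P \<in> ?I" for P
    using c that by (auto simp: projective_limit_def)
  have coherent: "block_around Q (c P) = c Q" if "(Q, P) \<in> coarsening_order X" for P Q
    using c that by (auto simp: projective_limit_def)
  have fip: "\<Inter> (c ` \<P>) \<noteq> {}" if \<P>: "finite \<P>" "\<P> \<noteq> {}" "\<P> \<subseteq> ?I" for \<P>
  proof -
    let ?R = "common_refinement \<P>"
    have R: "?R \<in> ?I"
      using common_refinement_in_finite_open_partitions[OF \<P>] .
    have "c ?R \<subseteq> c P" if P: "P \<in> \<P>" for P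
    proof -
      have ref: "refines (topspace X) ?R P"
        using \<P> P part by (intro refines_common_refinement) auto
      then have "block_around P (c ?R) = c P"
        using coherent R P \<P>(3) by (auto simp: coarsening_order_def)
      then show ?thesis
        using block_around_refines(2)[OF ref c_block[OF R]] by simp
    qed
    moreover have "c ?R \<noteq> {}"
      using c_block[OF R] partition_onD3[OF part[OF R]] by auto
    ultimately show ?thesis
      by blast
  qed
  \<comment> \<open>The trivial partition is the member of the family that puts the common point inside \<open>X\<close>. It is
     \<open>{}\<close> when \<open>X\<close> is empty, since blocks are nonempty.\<close>
  have "{topspace X} - {{}} \<in> ?I"
    by (auto simp: finite_open_partitions_def partition_on_def pairwise_def)
  then have I: "?I \<noteq> {}"
    by blast
  have "\<Inter> (c ` ?I) \<noteq> {}"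
  proof -
    have "\<Inter> \<F> \<noteq> {}" if \<F>: "finite \<F>" "\<F> \<subseteq> c ` ?I" for \<F>
    proof (cases "\<F> = {}")
      case False
      obtain \<P> where "\<P> \<subseteq> ?I" "finite \<P>" "\<F> = c ` \<P>"
        using finite_subset_image[OF \<F>] by blast
      with False show ?thesis
        using fip[of \<P>] by simp
    qed simp
    moreover have "\<forall>C\<in>c ` ?I. closedin X C"
      using closedin_block c_block by blast
    ultimately show ?thesis
      using \<open>compact_space X\<close>[unfolded compact_space_fip, rule_format, of "c ` ?I"] by simp
  qed
  then obtain x where x: "\<And>P. P \<in> ?I \<Longrightarrow> x \<in> c P"
    by blast
  moreover have "x \<in> topspace X"
    using I x c_block part partition_onD1 by blast
  ultimately show ?thesis
    by blast
qed

text \<open>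
  This is the only place where total disconnectedness enters. By itself it makes the connected
  components trivial, whereas a separation into two open sets needs trivial quasi-components;
  compactness and the Hausdorff property close the gap.
\<close>

lemma open_partition_separating_points:
  assumes "compact_space X" "Hausdorff_space X" "totally_disconnected_space X"
    and xy: "x \<in> topspace X" "y \<in> topspace X" "x \<noteq> y"
  obtains P where "P \<in> finite_open_partitions X" "block_around P {x} \<noteq> block_around P {y}"
proof -
  have "\<not> connected_component_of X x y"
  proof
    assume "connected_component_of X x y"
    then obtain S where "connectedin X S" "x \<in> S" "y \<in> S"
      unfolding connected_component_of_def by blast
    then show False
      using assms(3) \<open>x \<noteq> y\<close> unfolding totally_disconnected_space_def by blast
  qed
  then have "\<not> quasi_component_of X x y"
    using assms quasi_eq_connected_component_of[of X x] by simp
  then have "separated_between X {x} {y}"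
    using xy by (simp add: separated_between_singletons)
  then obtain U V where UV: "openin X U" "openin X V" "U \<union> V = topspace X" "disjnt U V"
      and x: "x \<in> U" and y: "y \<in> V"
    unfolding separated_between_def by auto
  let ?P = "{U, V}"
  have part: "partition_on (topspace X) ?P"
    using UV x y by (auto simp: partition_on_def pairwise_insert disjnt_sym)
  show ?thesis
  proof
    show "?P \<in> finite_open_partitions X"
      using part UV by (simp add: finite_open_partitions_def)
    have "block_around ?P {x} = U" "block_around ?P {y} = V"
      using block_around_eq[OF part] x y by auto
    then show "block_around ?P {x} \<noteq> block_around ?P {y}"
      using UV x by (auto simp: disjnt_def)
  qed
qed

text \<open>
  The preimage of a set of blocks is its union.
\<close>

lemma continuous_map_block_around:
  assumes "P \<in> finite_open_partitions X"
  shows "continuous_map X (discrete_topology P) (\<lambda>x. block_around P {x})"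
  unfolding continuous_map_def
proof (intro conjI allI impI)
  have part: "partition_on (topspace X) P" and op: "\<And>C. C \<in> P \<Longrightarrow> openin X C"
    using assms by (auto simp: finite_open_partitions_def)
  show "(\<lambda>x. block_around P {x}) \<in> topspace X \<rightarrow> topspace (discrete_topology P)"
    using block_around_point(1)[OF part] by auto
  fix \<U> assume "openin (discrete_topology P) \<U>"
  then have \<U>: "\<U> \<subseteq> P"
    by simp
  have "block_around P {x} = B" if "B \<in> \<U>" "x \<in> B" for x B
    using block_around_eq[OF part, of B "{x}"] that \<U> by auto
  then have "{x \<in> topspace X. block_around P {x} \<in> \<U>} = \<Union> \<U>"
    using block_around_point[OF part] \<U> partition_onD1[OF part] by blast
  also have "openin X \<dots>"
    using op \<U> by blast
  finally show "openin X {x \<in> topspace X. block_around P {x} \<in> \<U>}" .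
qed

theorem homeomorphic_space_limit_of_open_partitions:
  assumes X: "compact_space X" "Hausdorff_space X" "totally_disconnected_space X"
  shows "X homeomorphic_space limit_of_open_partitions X"
proof -
  let ?I = "finite_open_partitions X"
  let ?L = "limit_of_open_partitions X"
  define h where "h x = (\<lambda>P\<in>?I. block_around P {x})" for x
  have part: "partition_on (topspace X) P" if "P \<in> ?I" for P
    using that by (simp add: finite_open_partitions_def)
  have coherent: "block_around Q (h x P) = h x Q"
    if x: "x \<in> topspace X" and "(Q, P) \<in> coarsening_order X" for x P Q
  proof -
    have PQ: "P \<in> ?I" "Q \<in> ?I" "refines (topspace X) P Q"
      using that by (auto simp: coarsening_order_def)
    then show ?thesis
      using block_around_block_around[OF PQ(3), of "{x}"] block_around_point[OF part x]
      by (simp add: h_def)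
  qed
  have cont: "continuous_map X ?L h"
    unfolding projective_limit_def continuous_map_in_subtopology
  proof (intro conjI)
    show "continuous_map X (product_topology discrete_topology ?I) h"
      unfolding continuous_map_componentwise
      using continuous_map_block_around by (auto simp: h_def)
    show "h \<in> topspace X \<rightarrow>
        {c \<in> (\<Pi>\<^sub>E P\<in>?I. P). \<forall>P Q. (Q, P) \<in> coarsening_order X \<longrightarrow> block_around Q (c P) = c Q}"
      using coherent block_around_point(1)[OF part] by (auto simp: h_def)
  qed
  have inj: "inj_on h (topspace X)"
  proof (rule inj_onI)
    fix x y assume xy: "x \<in> topspace X" "y \<in> topspace X" and eq: "h x = h y"
    show "x = y"
    proof (rule ccontr)
      assume "x \<noteq> y"
      then obtain P where "P \<in> ?I" "block_around P {x} \<noteq> block_around P {y}"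
        using open_partition_separating_points[OF X xy] by blast
      then show False
        using fun_cong[OF eq, of P] by (simp add: h_def)
    qed
  qed
  have "topspace ?L \<subseteq> h ` topspace X"
  proof
    fix c assume c: "c \<in> topspace ?L"
    then obtain x where x: "x \<in> topspace X" "\<And>P. P \<in> ?I \<Longrightarrow> x \<in> c P"
      using coherent_blocks_have_common_point[OF X(1)] by blast
    have c': "c \<in> (\<Pi>\<^sub>E P\<in>?I. P)"
      using c by (simp add: projective_limit_def)
    have "h x = c"
    proof (rule extensionalityI)
      show "h x \<in> extensional ?I" "c \<in> extensional ?I"
        using c' by (auto simp: h_def PiE_def)
      fix P assume P: "P \<in> ?I"
      then have "block_around P {x} = c P"
        using c' x by (intro block_around_eq[OF part]) auto
      then show "h x P = c P"
        using P by (simp add: h_def)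
    qed
    with x(1) show "c \<in> h ` topspace X"
      by blast
  qed
  then have surj: "h ` topspace X = topspace ?L"
    using continuous_map_image_subset_topspace[OF cont] by blast
  have "Hausdorff_space ?L"
    by (rule Hausdorff_space_projective_limit[OF finite_projective_system_open_partitions])
  then have "homeomorphic_map X ?L h"
    by (intro continuous_imp_homeomorphic_map cont X(1) surj inj)
  then show ?thesis
    by (rule homeomorphic_map_imp_homeomorphic_space)
qed

theorem theorem3p8:
  fixes X :: "'a topology"
  shows "(profinite_space X \<longleftrightarrow>
            compact_space X \<and> Hausdorff_space X \<and> totally_disconnected_space X) \<and>
         (profinite_space_over TYPE('i) TYPE('b) X \<longrightarrow> profinite_space X)"
proof -
  have "profinite_space X"
    if "compact_space X \<and> Hausdorff_space X \<and> totally_disconnected_space X"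
    unfolding profinite_space_def profinite_space_over_def
    using that finite_projective_system_open_partitions homeomorphic_space_limit_of_open_partitions
    by blast
  moreover have "compact_space X \<and> Hausdorff_space X \<and> totally_disconnected_space X"
    if "profinite_space X"
    using that unfolding profinite_space_def by (rule profinite_space_over_imp)
  ultimately show ?thesis
    using profinite_space_over_imp by blast
qed

end
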